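(* Let $\phi=(1+\sqrt5)/2$ and, for $n\ge 0$, let $A_n=\lfloor \phi n\rfloor$ and $B_n=\lfloor \phi^2 n\rfloor$. For each integer $k\ge 0$, the $\mathcal{P}$-positions of the game $\mathcal{W}_k$ form the set $$\{(i,i)\mid 0\le i<k\}\cup\{(A_n+k,\,B_n+k)\mid n\ge 0\}.$$
   Context: For an integer $k\ge 0$, $\mathcal{W}_k$ is the following two-player game. A position is a pair $(a,b)$ of nonnegative integers (sizes of two piles of tokens); the piles are unordered, so $(a,b)$ and $(b,a)$ are identified, and a listed set of positions is understood up to this symmetry. Players alternate; a player who cannot move loses. Each move is one of: (i) remove a positive number of tokens from a single pile; (ii) remove an equal positive number of tokens from both piles, provided that neither pile has size less than $k$ after the move. ($\mathcal{W}_0$ is Wythoff's game.) A position is a $\mathcal{P}$-position if the player about to move from it does not have a winning strategy (the previous player wins); equivalently, if no move from it leads to a $\mathcal{P}$-position. *)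

theory Defs
  imports Complex_Main "HOL-Library.Uprod"
begin

definition phi :: real where
  "phi = (1 + sqrt 5) / 2"

definition A :: "nat \<Rightarrow> nat" where
  "A n = nat \<lfloor>phi * real n\<rfloor>"

definition B :: "nat \<Rightarrow> nat" where
  "B n = nat \<lfloor>phi\<^sup>2 * real n\<rfloor>"

text \<open>A position is an unordered pair of pile sizes, so rule \<open>single\<close> covers both piles.\<close>

type_synonym position = "nat uprod"

inductive move :: "nat \<Rightarrow> position \<Rightarrow> position \<Rightarrow> bool" for k :: nat where
  single: "0 < t \<Longrightarrow> move k (Upair (a + t) b) (Upair a b)"
| both: "0 < t \<Longrightarrow> k \<le> a \<Longrightarrow> k \<le> b \<Longrightarrow> move k (Upair (a + t) (b + t)) (Upair a b)"

text \<open>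
  The positions in which the player using \<open>s\<close> may have to move, when that player starts at
  \<open>p\<close> and the opponent replies arbitrarily.
\<close>

inductive reachable :: "nat \<Rightarrow> (position \<Rightarrow> position) \<Rightarrow> position \<Rightarrow> position \<Rightarrow> bool"
  for k :: nat and s :: "position \<Rightarrow> position" and p :: position where
  start: "reachable k s p p"
| reply: "reachable k s p q \<Longrightarrow> move k q (s q) \<Longrightarrow> move k (s q) r \<Longrightarrow> reachable k s p r"

text \<open>
  Every move decreases the number of tokens, so all plays are finite. Hence the player using
  \<open>s\<close> wins every play as soon as \<open>s\<close> always supplies a legal move.
\<close>

definition winning_strategy :: "nat \<Rightarrow> (position \<Rightarrow> position) \<Rightarrow> position \<Rightarrow> bool" where
  "winning_strategy k s p \<longleftrightarrow> (\<forall>q. reachable k s p q \<longrightarrow> move k q (s q))"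

definition P_position :: "nat \<Rightarrow> position \<Rightarrow> bool" where
  "P_position k p \<longleftrightarrow> \<not> (\<exists>s. winning_strategy k s p)"

lift_definition tokens :: "position \<Rightarrow> nat" is "\<lambda>(a, b). a + b"
  by auto

lemma tokens_Upair [simp]: "tokens (Upair a b) = a + b"
  by transfer simp

lemma move_tokens: "move k p q \<Longrightarrow> tokens q < tokens p"
  by (induction rule: move.induct) auto

text \<open>
  The strategies above are positional; the next inductive predicate characterizes winning
  without them, and leads to the recursive description of P-positions.
\<close>

inductive wins :: "nat \<Rightarrow> position \<Rightarrow> bool" for k :: nat where
  "move k p q \<Longrightarrow> (\<And>r. move k q r \<Longrightarrow> wins k r) \<Longrightarrow> wins k p"

lemma wins_imp_strategy:
  assumes "wins k p"
  shows "\<exists>s. winning_strategy k s p"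
proof -
  define s where "s p = (SOME q. move k p q \<and> (\<forall>r. move k q r \<longrightarrow> wins k r))" for p
  have s: "move k q (s q) \<and> (\<forall>r. move k (s q) r \<longrightarrow> wins k r)" if "wins k q" for q
    unfolding s_def by (rule someI_ex) (use that in \<open>auto elim: wins.cases\<close>)
  have "wins k q" if "reachable k s p q" for q
    using that by induction (use assms s in auto)
  with s show ?thesis
    by (auto simp: winning_strategy_def)
qed

lemma strategy_imp_wins:
  assumes "winning_strategy k s p"
  shows "wins k p"
proof -
  have "reachable k s p q \<Longrightarrow> wins k q" for q
  proof (induction "tokens q" arbitrary: q rule: less_induct)
    case less
    then have m: "move k q (s q)"
      using assms by (simp add: winning_strategy_def)
    show ?case
    proof (rule wins.intros[OF m])
      fix r assume "move k (s q) r"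
      with m less show "wins k r"
        by (meson move_tokens order.strict_trans reachable.reply)
    qed
  qed
  then show ?thesis
    by (simp add: reachable.start)
qed

lemma P_position_iff_not_wins: "P_position k p \<longleftrightarrow> \<not> wins k p"
  unfolding P_position_def using wins_imp_strategy strategy_imp_wins by blast

lemma P_position_iff: "P_position k p \<longleftrightarrow> (\<forall>q. move k p q \<longrightarrow> \<not> P_position k q)"
proof (induction "tokens p" arbitrary: p rule: less_induct)
  case less
  have "wins k p \<longleftrightarrow> (\<exists>q. move k p q \<and> (\<forall>r. move k q r \<longrightarrow> wins k r))"
    by (subst wins.simps) auto
  then show ?case
    using less move_tokens by (fastforce simp: P_position_iff_not_wins)
qed

end

theory Submission
  imports Defs
begin

text \<open>
  Wythoff's game \<open>k = 0\<close> rests on two facts about \<open>A\<close> and \<open>B\<close>: \<open>B n = A n + n\<close>, so that the pairs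
  \<open>(A n, B n)\<close> realise each difference exactly once (\<open>B_eq_A_plus\<close>), and the theorem of Beatty, by
  which each positive number is \<open>A n\<close> or \<open>B n\<close> for exactly one \<open>n\<close> (\<open>A_or_B\<close>, \<open>A_eq_B\<close>).
  Consequently no move leads from one such pair to another: a move in a single pile would put one
  number into two pairs, and a move in both piles would give two pairs the same difference.
  Conversely, every other position \<open>(x, y)\<close> with \<open>x \<le> y\<close> has a move to such a pair. If \<open>x = B n\<close>, or
  if \<open>x = A n\<close> and \<open>y > B n\<close>, lowering the larger pile to the partner of \<open>x\<close> works; if \<open>x = A n\<close> and
  \<open>y < B n\<close>, then \<open>y - x < n\<close>, and the pair with difference \<open>y - x\<close> lies below \<open>(x, y)\<close> on the diagonal.

  For general \<open>k\<close>, the positions with both piles at least \<open>k\<close> form a copy of Wythoff's game, shifted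
  by \<open>k\<close>, as the restriction on diagonal moves says exactly that the shifted piles stay nonnegative.
  The only moves that leave this copy lower one pile below \<open>k\<close> and keep the other at least \<open>k\<close>.
  If the smaller pile is below \<open>k\<close>, diagonal moves are impossible and the game is two-pile Nim, where
  one wins by equalising the piles. The equal pairs \<open>(i, i)\<close> with \<open>i < k\<close> cannot be reached from the
  copy in one move, hence the two analyses do not interfere.
\<close>

section \<open>The golden ratio\<close>

lemma phi_gt_1: "phi > 1"
  by (simp add: phi_def)

lemma phi_square: "phi\<^sup>2 = phi + 1"
  by (simp add: phi_def power2_eq_square field_simps)

text \<open>
  Infinite descent: a solution \<open>(m, n)\<close> gives the smaller solution \<open>(n, m - n)\<close>. Since \<open>\<phi>\<close> is a root of
  \<open>x\<^sup>2 = x + 1\<close>, this is its irrationality.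
\<close>

lemma golden_equation_nat:
  fixes m n :: nat
  assumes "m * m = m * n + n * n"
  shows "n = 0"
  using assms
proof (induction n arbitrary: m rule: less_induct)
  case (less n)
  show ?case
  proof (rule ccontr)
    assume "n \<noteq> 0"
    have "n \<le> m"
    proof (rule ccontr)
      assume "\<not> n \<le> m"
      then have "m * m < n * n"
        by (simp add: mult_strict_mono)
      with less.prems show False by simp
    qed
    then obtain d where d: "m = n + d"
      using le_Suc_ex by blast
    have eq: "n * n = n * d + d * d"
      using less.prems by (simp add: d algebra_simps)
    have "d < n"
    proof (rule ccontr)
      assume "\<not> d < n"
      then have "n * n \<le> n * d" "n * n \<le> d * d"
        by (auto intro: mult_mono)
      with eq \<open>n \<noteq> 0\<close> show False by auto
    qed
    with less.IH eq have "d = 0" by blast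
    with eq \<open>n \<noteq> 0\<close> show False by simp
  qed
qed

lemma phi_times_nat_eq_nat:
  assumes "phi * real n = real m"
  shows "n = 0"
proof -
  have "real (m * m) = phi\<^sup>2 * real n * real n"
    by (simp add: assms[symmetric] power2_eq_square)
  also have "\<dots> = (phi * real n) * real n + real n * real n"
    by (simp add: phi_square algebra_simps)
  also have "\<dots> = real (m * n + n * n)"
    by (simp add: assms)
  finally show ?thesis
    by (intro golden_equation_nat) (simp only: of_nat_eq_iff)
qed

section \<open>The Beatty sequences A and B\<close>

lemma A_eq_iff: "A n = m \<longleftrightarrow> real m \<le> phi * real n \<and> phi * real n < real m + 1"
proof -
  have "0 \<le> phi * real n" using phi_gt_1 by simp
  then show ?thesis
    unfolding A_def by (auto simp: nat_eq_iff floor_eq_iff)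
qed

lemma B_eq_A_plus: "B n = A n + n"
proof -
  have "phi\<^sup>2 * real n = phi * real n + of_int (int n)"
    by (simp add: phi_square algebra_simps)
  moreover have "0 \<le> phi * real n" using phi_gt_1 by simp
  ultimately show ?thesis
    unfolding A_def B_def floor_add_int[symmetric] by (simp add: nat_add_distrib)
qed

lemma A_le: "real (A n) \<le> phi * real n"
  and less_A: "phi * real n < real (A n) + 1"
  using A_eq_iff by blast+

lemma A_0 [simp]: "A 0 = 0" and B_0 [simp]: "B 0 = 0"
  by (simp_all add: A_def B_def)

lemma A_less: "m < n \<Longrightarrow> A m < A n"
proof -
  assume "m < n"
  then have "phi * (real m + 1) \<le> phi * real n"
    using phi_gt_1 by (intro mult_left_mono) auto
  then have "real (A m) + 1 < real (A n) + 1"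
    using A_le[of m] less_A[of n] phi_gt_1 by (simp add: algebra_simps)
  then show ?thesis by simp
qed

lemma A_inject [simp]: "A m = A n \<longleftrightarrow> m = n"
  using A_less by (metis less_irrefl linorder_neqE_nat)

lemma B_inject [simp]: "B m = B n \<longleftrightarrow> m = n"
  using A_less by (metis B_eq_A_plus add_strict_mono less_irrefl linorder_neqE_nat)

text \<open>
  If \<open>m\<close> were a common positive value, then \<open>n\<close> would lie strictly between \<open>m / \<phi>\<close> and \<open>(m + 1) / \<phi>\<close>, and
  \<open>j\<close> strictly between \<open>m / \<phi>\<^sup>2\<close> and \<open>(m + 1) / \<phi>\<^sup>2\<close>. As \<open>1 / \<phi> + 1 / \<phi>\<^sup>2 = 1\<close>, the integer \<open>n + j\<close> would
  lie strictly between \<open>m\<close> and \<open>m + 1\<close>. The proof multiplies these bounds by \<open>\<phi>\<^sup>2\<close>.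
\<close>

lemma A_eq_B:
  assumes "A n = B j"
  shows "n = 0 \<and> j = 0"
proof (rule ccontr)
  assume nonzero: "\<not> (n = 0 \<and> j = 0)"
  define m where "m = A n"
  have m: "m = A j + j" using assms by (simp add: m_def B_eq_A_plus)
  have n: "real m \<le> phi * real n" "phi * real n < real m + 1"
    using A_le less_A by (auto simp: m_def)
  have j: "real m \<le> phi * real j + real j" "phi * real j + real j < real m + 1"
    using A_le[of j] less_A[of j] by (simp_all add: m)
  have square: "phi * (phi * x) = phi * x + x" for x
    using phi_square by (simp add: power2_eq_square algebra_simps flip: mult.assoc)
  have upper: "phi * (phi * real n) < phi * (real m + 1)"
    using n phi_gt_1 by simp
  have lower: "phi * real m \<le> phi * (phi * real n)"
    using n phi_gt_1 by simp
  have "phi\<^sup>2 * real (n + j) < phi\<^sup>2 * real (m + 1)"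
    using upper j square[of "real n"] by (simp add: phi_square algebra_simps)
  then have "n + j < m + 1"
    using phi_gt_1 by simp
  have "phi\<^sup>2 * real m \<le> phi\<^sup>2 * real (n + j)"
    using lower j square[of "real n"] by (simp add: phi_square algebra_simps)
  then have "m \<le> n + j"
    using phi_gt_1 by simp
  \<comment> \<open>Equality forces \<open>m \<le> \<phi> n\<close> and \<open>m \<le> \<phi>\<^sup>2 j\<close> to be equalities, which irrationality excludes.\<close>
  with \<open>n + j < m + 1\<close> have mnj: "m = n + j" by simp
  then have "phi * real m = phi * real n + phi * real j"
    by (simp add: algebra_simps)
  with mnj lower j square[of "real n"] have "phi * (phi * real n) = phi * real m"
    by simp
  then have "phi * real n = real m"
    using phi_gt_1 by simp
  then have "n = 0" by (rule phi_times_nat_eq_nat)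
  then have "m = 0" by (simp add: m_def)
  with mnj nonzero show False by simp
qed

text \<open>
  Take the largest \<open>n\<close> with \<open>\<phi> n < m + 1\<close>. If \<open>A n \<noteq> m\<close>, then \<open>n < m / \<phi>\<close> and \<open>n + 1 \<ge> (m + 1) / \<phi>\<close>;
  subtracting from \<open>m\<close> and from \<open>m + 1\<close> puts \<open>m - n\<close> between \<open>m / \<phi>\<^sup>2\<close> and \<open>(m + 1) / \<phi>\<^sup>2\<close>. By
  irrationality the upper bound is strict, so \<open>B (m - n) = m\<close>.
\<close>

lemma A_or_B: "\<exists>n. A n = m \<or> B n = m"
proof -
  define n where "n = nat \<lceil>(real m + 1) / phi\<rceil> - 1"
  have ceil: "\<lceil>(real m + 1) / phi\<rceil> \<ge> 1"
    using phi_gt_1 by (simp add: field_simps add_pos_nonneg)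
  then have n_int: "int n = \<lceil>(real m + 1) / phi\<rceil> - 1"
    unfolding n_def by linarith
  have real_n: "real n = of_int \<lceil>(real m + 1) / phi\<rceil> - 1"
    using n_int by (metis of_int_1 of_int_diff of_int_of_nat_eq)
  have "real n < (real m + 1) / phi" "(real m + 1) / phi \<le> real n + 1"
    unfolding real_n by linarith+
  then have n: "phi * real n < real m + 1" "real m + 1 \<le> phi * (real n + 1)"
    using phi_gt_1 by (simp_all add: field_simps)
  show ?thesis
  proof (cases "real m \<le> phi * real n")
    case True
    with n A_eq_iff show ?thesis by blast
  next
    case False
    have "real n \<le> phi * real n"
      using phi_gt_1 by (simp add: mult_le_cancel_right1)
    with False have "n \<le> m" by simp
    then obtain j where j: "m = n + j"
      using le_Suc_ex by blast
    have square: "phi * (phi * x) = phi * x + x" for x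
      using phi_square by (simp add: power2_eq_square algebra_simps flip: mult.assoc)
    have "phi * (phi * real n) < phi * real m"
      using False phi_gt_1 by simp
    then have lower: "real n < phi * real j"
      using square[of "real n"] by (simp add: j algebra_simps)
    have "phi * (real m + 1) \<le> phi * (phi * (real n + 1))"
      using n phi_gt_1 by simp
    then have upper: "phi * real j \<le> real n + 1"
      using square[of "real n + 1"] by (simp add: j algebra_simps)
    have "phi * real j \<noteq> real n + 1"
    proof
      assume "phi * real j = real n + 1"
      then have "phi * real j = real (n + 1)" by simp
      then have "j = 0" by (rule phi_times_nat_eq_nat)
      with lower show False by simp
    qed
    with lower upper have "A j = n"
      using A_eq_iff[of j n] by simp
    then have "B j = m"
      by (simp add: B_eq_A_plus j)
    then show ?thesis by blast
  qed
qed

section \<open>Wythoff pairs\<close>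

definition wythoff_pair :: "nat \<Rightarrow> nat \<Rightarrow> bool" where
  "wythoff_pair x y \<longleftrightarrow> (\<exists>n. x = A n \<and> y = B n \<or> x = B n \<and> y = A n)"

lemma wythoff_pair_commute: "wythoff_pair x y \<longleftrightarrow> wythoff_pair y x"
  by (auto simp: wythoff_pair_def)

lemma wythoff_pair_A_B: "wythoff_pair (A n) (B n)"
  by (auto simp: wythoff_pair_def)

lemma wythoff_pair_unique:
  assumes "wythoff_pair x y" "wythoff_pair x y'"
  shows "y = y'"
  using assms unfolding wythoff_pair_def by (metis A_eq_B A_inject B_inject)

text \<open>
  The difference of a Wythoff pair is its index up to sign. The sign matters only in comparing
  \<open>(A n, B n)\<close> with \<open>(B n', A n')\<close>, where both indices must vanish.
\<close>

lemma wythoff_pair_same_difference: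
  assumes "wythoff_pair (x + t) (y + t)" "wythoff_pair x y"
  shows "t = 0"
proof -
  obtain n where n: "x + t = A n \<and> y + t = A n + n \<or> x + t = A n + n \<and> y + t = A n"
    using assms(1) by (auto simp: wythoff_pair_def B_eq_A_plus)
  obtain n' where n': "x = A n' \<and> y = A n' + n' \<or> x = A n' + n' \<and> y = A n'"
    using assms(2) by (auto simp: wythoff_pair_def B_eq_A_plus)
  from n n' have "n = n'" by auto
  with n n' show ?thesis by auto
qed

lemma wythoff_pair_reply:
  assumes "\<not> wythoff_pair x y" "x \<le> y"
  shows "(\<exists>y'<y. wythoff_pair x y') \<or>
    (\<exists>x' y' t. 0 < t \<and> x = x' + t \<and> y = y' + t \<and> wythoff_pair x' y')"
proof -
  consider n where "x = B n" | n where "x = A n" "B n < y" | n where "x = A n" "y < B n"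
    using A_or_B[of x] assms(1) wythoff_pair_A_B by (metis linorder_neqE_nat)
  then show ?thesis
  proof cases
    case 1
    then have "wythoff_pair x (A n)"
      by (simp add: wythoff_pair_commute wythoff_pair_A_B)
    moreover from this assms have "A n \<noteq> y" by auto
    moreover have "A n \<le> y" using 1 assms(2) by (simp add: B_eq_A_plus)
    ultimately show ?thesis by auto
  next
    case 2
    then show ?thesis using wythoff_pair_A_B by blast
  next
    case 3
    define d where "d = y - x"
    have y: "y = A n + d" "d < n"
      using 3 assms(2) by (auto simp: d_def B_eq_A_plus)
    obtain t where "A n = A d + t" "0 < t"
      using A_less[OF y(2)] less_imp_add_positive by metis
    then have "0 < t \<and> x = A d + t \<and> y = B d + t \<and> wythoff_pair (A d) (B d)"
      using y 3 wythoff_pair_A_B[of d] by (simp add: B_eq_A_plus)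
    then show ?thesis by blast
  qed
qed

section \<open>The P-positions\<close>

text \<open>
  The P-positions are the only kernel of the move graph: the tokens decrease in each move, so
  membership is determined by recursion.
\<close>

lemma P_position_eq_kernel:
  assumes stable: "\<And>p q. p \<in> K \<Longrightarrow> move k p q \<Longrightarrow> q \<notin> K"
    and absorbing: "\<And>p. p \<notin> K \<Longrightarrow> \<exists>q\<in>K. move k p q"
  shows "{p. P_position k p} = K"
proof -
  have "P_position k p \<longleftrightarrow> p \<in> K" for p
  proof (induction "tokens p" arbitrary: p rule: less_induct)
    case less
    then have "P_position k q \<longleftrightarrow> q \<in> K" if "move k p q" for q
      using that move_tokens by blast
    then show ?case
      using P_position_iff[of k p] stable[of p] absorbing[of p] by blast
  qed
  then show ?thesis by blast
qed

lemma single_other: "y < b \<Longrightarrow> move k (Upair a b) (Upair a y)"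
proof -
  assume "y < b"
  then have "move k (Upair b a) (Upair y a)"
    using move.single[of "b - y" k y a] by simp
  moreover have "Upair c a = Upair a c" for c
    by simp
  ultimately show ?thesis by metis
qed

definition cold_positions :: "nat \<Rightarrow> position set" where
  "cold_positions k = {Upair i i | i. i < k} \<union> {Upair (A n + k) (B n + k) | n. True}"

lemma Upair_in_cold_positions:
  "Upair a b \<in> cold_positions k \<longleftrightarrow>
    a = b \<and> a < k \<or> k \<le> a \<and> k \<le> b \<and> wythoff_pair (a - k) (b - k)"
proof -
  have "(\<exists>n. Upair a b = Upair (A n + k) (B n + k)) \<longleftrightarrow>
      k \<le> a \<and> k \<le> b \<and> wythoff_pair (a - k) (b - k)"
    unfolding wythoff_pair_def Upair_inject by (auto; metis le_add_diff_inverse2)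
  then show ?thesis
    unfolding cold_positions_def by auto
qed

lemma cold_positions_stable:
  assumes "move k p q" "p \<in> cold_positions k"
  shows "q \<notin> cold_positions k"
  using assms(1)
proof cases
  case (single t a b)
  show ?thesis
  proof
    assume "q \<in> cold_positions k"
    with single assms(2)
    have "k \<le> a" "wythoff_pair (b - k) (a + t - k)" "wythoff_pair (b - k) (a - k)"
      by (auto simp: Upair_in_cold_positions wythoff_pair_commute)
    then have "a + t - k = a - k"
      by (blast intro: wythoff_pair_unique)
    with \<open>k \<le> a\<close> \<open>0 < t\<close> show False by simp
  qed
next
  case (both t a b)
  show ?thesis
  proof
    assume "q \<in> cold_positions k"
    with both assms(2)
    have "wythoff_pair ((a - k) + t) ((b - k) + t)" "wythoff_pair (a - k) (b - k)"
      by (auto simp: Upair_in_cold_positions)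
    then have "t = 0" by (rule wythoff_pair_same_difference)
    with \<open>0 < t\<close> show False by simp
  qed
qed

lemma cold_positions_absorbing:
  assumes "p \<notin> cold_positions k"
  shows "\<exists>q\<in>cold_positions k. move k p q"
proof -
  obtain a b where p: "p = Upair a b" and "a \<le> b"
    by (cases p rule: uprod_exhaust) (metis Upair_inject nle_le)
  show ?thesis
  proof (cases "a < k")
    case True
    with assms p \<open>a \<le> b\<close> have "a < b"
      by (auto simp: Upair_in_cold_positions)
    then have "move k p (Upair a a)"
      unfolding p by (rule single_other)
    moreover have "Upair a a \<in> cold_positions k"
      using True by (simp add: Upair_in_cold_positions)
    ultimately show ?thesis by blast
  next
    case False
    with assms p \<open>a \<le> b\<close> have "\<not> wythoff_pair (a - k) (b - k)" "a - k \<le> b - k"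
      by (auto simp: Upair_in_cold_positions)
    from wythoff_pair_reply[OF this] show ?thesis
    proof (elim disjE exE conjE)
      fix y assume y: "y < b - k" "wythoff_pair (a - k) y"
      then have "Upair a (y + k) \<in> cold_positions k"
        using False by (simp add: Upair_in_cold_positions)
      moreover have "move k p (Upair a (y + k))"
        unfolding p using y by (intro single_other) simp
      ultimately show ?thesis by blast
    next
      fix x y t assume t: "0 < t" "a - k = x + t" "b - k = y + t" "wythoff_pair x y"
      then have "Upair (x + k) (y + k) \<in> cold_positions k"
        by (simp add: Upair_in_cold_positions)
      moreover have "a = x + k + t" "b = y + k + t"
        using t False \<open>a \<le> b\<close> by linarith+
      then have "move k p (Upair (x + k) (y + k))"
        unfolding p using t(1) by (simp only:) (rule move.both, simp_all)
      ultimately show ?thesis by blast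
    qed
  qed
qed

theorem theorem3:
  fixes k :: nat
  shows "{p. P_position k p} =
    {Upair i i | i. i < k} \<union> {Upair (A n + k) (B n + k) | n. True}"
  unfolding cold_positions_def[symmetric]
  using cold_positions_stable cold_positions_absorbing by (rule P_position_eq_kernel)

end
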